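(* For every $n \in \mathbb{N}$, there is a (finite, simple, undirected) graph $G$ with $\chi(G) \geq n$ and $\omega(G) \leq 3$ such that every induced subgraph $H$ of $G$ with $\omega(H) \leq 2$ satisfies $\chi(H) \leq 4$.
   Context: $\chi$ denotes chromatic number and $\omega$ denotes clique number. *)

theory Defs
  imports Main
begin

definition simple_graph :: "'a set \<Rightarrow> ('a \<Rightarrow> 'a \<Rightarrow> bool) \<Rightarrow> bool" where
  "simple_graph V E \<longleftrightarrow> finite V \<and> (\<forall>x y. E x y \<longrightarrow> x \<in> V \<and> y \<in> V)
     \<and> (\<forall>x. \<not> E x x) \<and> (\<forall>x y. E x y \<longrightarrow> E y x)"

definition induced :: "'a set \<Rightarrow> ('a \<Rightarrow> 'a \<Rightarrow> bool) \<Rightarrow> ('a \<Rightarrow> 'a \<Rightarrow> bool)" where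
  "induced S E = (\<lambda>x y. x \<in> S \<and> y \<in> S \<and> E x y)"

definition is_clique :: "'a set \<Rightarrow> ('a \<Rightarrow> 'a \<Rightarrow> bool) \<Rightarrow> 'a set \<Rightarrow> bool" where
  "is_clique V E K \<longleftrightarrow> K \<subseteq> V \<and> (\<forall>x\<in>K. \<forall>y\<in>K. x \<noteq> y \<longrightarrow> E x y)"

definition clique_number :: "'a set \<Rightarrow> ('a \<Rightarrow> 'a \<Rightarrow> bool) \<Rightarrow> nat" where
  "clique_number V E = Max {card K | K. is_clique V E K}"

definition proper_colouring :: "'a set \<Rightarrow> ('a \<Rightarrow> 'a \<Rightarrow> bool) \<Rightarrow> nat \<Rightarrow> ('a \<Rightarrow> nat) \<Rightarrow> bool" where
  "proper_colouring V E k c \<longleftrightarrow> (\<forall>x\<in>V. c x < k) \<and> (\<forall>x\<in>V. \<forall>y\<in>V. E x y \<longrightarrow> c x \<noteq> c y)"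

definition chromatic_number :: "'a set \<Rightarrow> ('a \<Rightarrow> 'a \<Rightarrow> bool) \<Rightarrow> nat" where
  "chromatic_number V E = (LEAST k. \<exists>c. proper_colouring V E k c)"

end

theory Submission
  imports Defs "HOL-Library.Countable"
begin

text \<open>
  Let \<open>D\<close> be an acyclic digraph in which any two vertices are joined by at most one directed path,
  and let \<open>L x y\<close> be the length of the path from \<open>x\<close> to \<open>y\<close>. Then \<open>L\<close> is additive along chains.
  Join \<open>x\<close> and \<open>y\<close> whenever the length of the path between them is not divisible by 3. A clique is
  a chain, and the distances from its least element are distinct modulo 3, so it has at most three
  elements. If \<open>x \<rightarrow> y \<rightarrow> z\<close> are two paths of the same nonzero length modulo 3, then \<open>x, y, z\<close> form
  a triangle; hence in a triangle-free induced subgraph the pairs at distance 1 modulo 3, and likewise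
  those at distance 2, form a bipartite graph, and the two bipartitions give a 4-colouring.

  Digraphs \<open>D\<close> of large chromatic number arise recursively (in the manner of Zykov, and of Kierstead
  and Trotter): take \<open>n\<close> disjoint copies of the \<open>n\<close>-th digraph, and for each choice of one vertex
  from every copy add a new source with arcs to the chosen vertices.
\<close>

section \<open>Additive path lengths\<close>

text \<open>The value 0 encodes that there is no nontrivial path from \<open>x\<close> to \<open>y\<close>.\<close>

locale additive_length =
  fixes L :: "'a \<Rightarrow> 'a \<Rightarrow> nat"
  assumes additive: "L x y > 0 \<Longrightarrow> L y z > 0 \<Longrightarrow> L x z = L x y + L y z"
begin

definition adj :: "'a \<Rightarrow> 'a \<Rightarrow> bool" where
  "adj x y \<longleftrightarrow> L x y mod 3 \<noteq> 0 \<or> L y x mod 3 \<noteq> 0"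

lemma length_self: "L x x = 0"
  using additive[of x x x] by (cases "L x x") auto

lemma length_asym: "L x y > 0 \<Longrightarrow> L y x = 0"
  using additive[of x y x] length_self[of x] by (cases "L y x") auto

lemma adj_irrefl: "\<not> adj x x"
  by (simp add: adj_def length_self)

lemma adj_sym: "adj x y \<Longrightarrow> adj y x"
  by (auto simp: adj_def)

lemma ex_minimal:
  assumes "finite K" "K \<noteq> {}"
  obtains m where "m \<in> K" "\<And>x. x \<in> K \<Longrightarrow> L x m = 0"
proof -
  have "asymp_on K (\<lambda>x y. L x y > 0)"
    by (rule asymp_onI) (simp add: length_asym)
  moreover have "transp_on K (\<lambda>x y. L x y > 0)"
    by (rule transp_onI) (simp add: additive)
  ultimately obtain m where "m \<in> K" "\<forall>x\<in>K. x \<noteq> m \<longrightarrow> \<not> L x m > 0"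
    using Finite_Set.bex_min_element[OF assms(1) _ _ assms(2)] by blast
  then show thesis
    using that length_self by (metis gr0I)
qed

lemma card_adj_clique_le:
  assumes "finite K" and clique: "\<And>x y. x \<in> K \<Longrightarrow> y \<in> K \<Longrightarrow> x \<noteq> y \<Longrightarrow> adj x y"
  shows "card K \<le> 3"
proof (cases "K = {}")
  case False
  with \<open>finite K\<close> obtain m where m: "m \<in> K" "\<And>x. x \<in> K \<Longrightarrow> L x m = 0"
    using ex_minimal by blast
  \<comment> \<open>If \<open>x = m\<close>, then \<open>L m x = 0\<close>. Otherwise minimality of
    \<open>m\<close> orients the edge between \<open>m\<close> and \<open>x\<close> away from
    \<open>m\<close>, so \<open>L m y\<close> exceeds \<open>L m x\<close> by
    \<open>L x y\<close>.\<close>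
  have sep: "L m x mod 3 \<noteq> L m y mod 3" if "x \<in> K" "y \<in> K" "L x y mod 3 \<noteq> 0" for x y
  proof (cases "x = m")
    case True
    then show ?thesis using that length_self by auto
  next
    case False
    then have "L m x > 0"
      using clique[of m x] m that by (auto simp: adj_def intro: gr0I)
    moreover have "L x y > 0"
      using that by (auto intro: gr0I)
    ultimately have "L m y = L m x + L x y"
      using additive by blast
    then show ?thesis using that by presburger
  qed
  have "inj_on (\<lambda>x. L m x mod 3) K"
    using sep clique unfolding inj_on_def adj_def by metis
  moreover have "(\<lambda>x. L m x mod 3) ` K \<subseteq> {..<3}" by auto
  ultimately show ?thesis
    by (metis card_inj_on_le card_lessThan finite_lessThan)
qed simp

text \<open>The two lengths add up to residue \<open>2 * r\<close>, which is again nonzero modulo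
  3.\<close>

lemma triangle_if_equal_residues:
  assumes "L x y mod 3 = r" "L y z mod 3 = r" "r \<noteq> 0"
  shows "adj x y" "adj y z" "adj x z" "card {x, y, z} = 3"
proof -
  have "L x y > 0" "L y z > 0"
    using assms by (auto intro: gr0I)
  then have "L x z = L x y + L y z"
    using additive by blast
  then have "L x z mod 3 \<noteq> 0"
    using assms by presburger
  then show adj: "adj x y" "adj y z" "adj x z"
    using assms by (auto simp: adj_def)
  show "card {x, y, z} = 3"
    using adj adj_irrefl by (auto simp: card_insert_if)
qed

lemma four_colouring:
  assumes tf: "\<And>x y z. \<lbrakk>x \<in> S; y \<in> S; z \<in> S; adj x y; adj y z; adj x z\<rbrakk> \<Longrightarrow> card {x, y, z} \<noteq> 3"
  obtains c where "\<And>x. c x < (4::nat)" "\<And>x y. \<lbrakk>x \<in> S; y \<in> S; adj x y\<rbrakk> \<Longrightarrow> c x \<noteq> c y"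
proof -
  \<comment> \<open>If \<open>L x y\<close> has residue \<open>r\<close>, then
    \<open>out r x\<close> holds, and \<open>out r y\<close> would complete a triangle. So
    \<open>out r\<close> separates such pairs for \<open>r = 1\<close> and \<open>r = 2\<close>;
    \<open>c\<close> packs both bits.\<close>
  define out where "out r x \<longleftrightarrow> (\<exists>y\<in>S. L x y mod 3 = r)" for r x
  define c where "c x = of_bool (out 1 x) + 2 * (of_bool (out 2 x) :: nat)" for x :: 'a
  have c_lt: "c x < 4" for x
    by (simp add: c_def)
  have out_iff: "out 1 x \<longleftrightarrow> odd (c x)" "out 2 x \<longleftrightarrow> c x \<ge> 2" for x
    by (simp_all add: c_def of_bool_def)
  have step: "c x \<noteq> c y" if "x \<in> S" "y \<in> S" "L x y mod 3 \<noteq> 0" for x y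
  proof
    assume eq: "c x = c y"
    define r where "r = L x y mod 3"
    have "r = 1 \<or> r = 2"
      using that unfolding r_def by presburger
    moreover have "out r x"
      using that by (auto simp: out_def r_def)
    ultimately have "out r y"
      using out_iff eq by metis
    then obtain z where "z \<in> S" "L y z mod 3 = r"
      by (auto simp: out_def)
    then show False
      using tf triangle_if_equal_residues[of x y r z] that r_def by metis
  qed
  show thesis
    using that[of c] c_lt step unfolding adj_def by metis
qed

end

section \<open>Cliques and colourings of finite graphs\<close>

lemma finite_clique_cards: "finite V \<Longrightarrow> finite {card K | K. is_clique V E K}"
  by (rule finite_subset[of _ "card ` Pow V"]) (auto simp: is_clique_def)

lemma card_le_clique_number:
  "finite V \<Longrightarrow> is_clique V E K \<Longrightarrow> card K \<le> clique_number V E"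
  unfolding clique_number_def using finite_clique_cards by (fastforce intro: Max_ge)

lemma clique_number_le:
  assumes "finite V" "\<And>K. is_clique V E K \<Longrightarrow> card K \<le> k"
  shows "clique_number V E \<le> k"
proof -
  have "is_clique V E {}" by (simp add: is_clique_def)
  then show ?thesis
    unfolding clique_number_def
    using finite_clique_cards[OF assms(1), of E] assms(2) by (subst Max_le_iff) auto
qed

lemma chromatic_number_le: "proper_colouring V E k c \<Longrightarrow> chromatic_number V E \<le> k"
  unfolding chromatic_number_def by (auto intro: Least_le)

lemma ex_chromatic_colouring:
  assumes "simple_graph V E"
  obtains c where "proper_colouring V E (chromatic_number V E) c"
proof -
  have "finite V"
    using assms by (simp add: simple_graph_def)
  then obtain h where h: "bij_betw h V {0..<card V}"
    using ex_bij_betw_finite_nat by blast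
  have "proper_colouring V E (card V) h"
    using assms h bij_betwE[OF h] unfolding proper_colouring_def simple_graph_def
    by (auto dest!: bij_betw_imp_inj_on dest: inj_onD)
  then have "\<exists>k c. proper_colouring V E k c" by blast
  from LeastI_ex[OF this] show thesis
    using that by (auto simp: chromatic_number_def)
qed

section \<open>The recursive construction\<close>

datatype vertex = Copy nat vertex | Apex "vertex list"

instance vertex :: countable
  by countable_datatype

text \<open>The source \<open>Apex xs\<close> has an arc to the vertex \<open>xs ! i\<close> of the \<open>i\<close>-th copy.\<close>

fun path_length :: "vertex \<Rightarrow> vertex \<Rightarrow> nat" where
  "path_length (Copy i x) (Copy j y) = (if i = j then path_length x y else 0)"
| "path_length (Apex xs) (Copy i y) =
     (if i < length xs \<and> (xs ! i = y \<or> path_length (xs ! i) y > 0)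
      then Suc (path_length (xs ! i) y) else 0)"
| "path_length _ (Apex _) = 0"

fun level :: "nat \<Rightarrow> vertex set" where
  "level 0 = {}"
| "level (Suc n) = (\<Union>i<n. Copy i ` level n) \<union> Apex ` {xs. set xs \<subseteq> level n \<and> length xs = n}"

lemma path_length_self: "path_length x x = 0"
  by (induction x) auto

interpretation vertex: additive_length path_length
proof
  show "path_length x z = path_length x y + path_length y z"
    if "path_length x y > 0" "path_length y z > 0" for x y z
    using that
  proof (induction z arbitrary: x y)
    case step: (Copy j z)
    show ?case
    proof (cases y)
      case (Apex ys)
      with step.prems(1) show ?thesis by simp
    next
      case (Copy i y')
      with step.prems(2) have "i = j" "path_length y' z > 0"
        by (simp_all split: if_splits)
      \<comment> \<open>Below a common tag the induction hypothesis applies directly. For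
        \<open>x = Apex xs\<close> it applies to \<open>xs ! i\<close>, unless
        \<open>xs ! i = y'\<close>, where the first length is 1.\<close>
      with Copy step.prems(1) step.IH[of _ y'] show ?thesis
        by (cases x) (auto simp: path_length_self split: if_splits)
    qed
  qed simp
qed

lemma finite_level: "finite (level n)"
  by (induction n) (auto intro: finite_lists_length_eq)

text \<open>Counting the colours that occur drives the induction: if at most \<open>n\<close> occur
  on \<open>level (Suc n)\<close>, each of the \<open>n\<close> copies already shows all of
  them.\<close>

lemma card_colours_level:
  assumes "\<And>x y. x \<in> level n \<Longrightarrow> y \<in> level n \<Longrightarrow> vertex.adj x y \<Longrightarrow> c x \<noteq> c y"
  shows "n \<le> card (c ` level n)"
  using assms
proof (induction n arbitrary: c)
  case (Suc n)
  let ?C = "c ` level (Suc n)"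
  show ?case
  proof (rule ccontr)
    assume "\<not> Suc n \<le> card ?C"
    then have le: "card ?C \<le> n" by simp
    have fin: "finite ?C" using finite_level by blast
    have copy: "(\<lambda>x. c (Copy i x)) ` level n = ?C \<and> card ?C = n" if "i < n" for i
    proof -
      have sub: "(\<lambda>x. c (Copy i x)) ` level n \<subseteq> ?C"
        using that by auto
      have "n \<le> card ((\<lambda>x. c (Copy i x)) ` level n)"
      proof (rule Suc.IH)
        fix x y assume "x \<in> level n" "y \<in> level n" "vertex.adj x y"
        then show "c (Copy i x) \<noteq> c (Copy i y)"
          using that by (intro Suc.prems) (auto simp: vertex.adj_def)
      qed
      then show ?thesis
        using card_seteq[OF fin sub] card_mono[OF fin sub] le by linarith
    qed
    \<comment> \<open>For \<open>n = 0\<close> there is no copy, and \<open>le\<close> alone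
      decides.\<close>
    have "card ?C = n"
      using copy[of 0] le by (cases "n = 0") auto
    then obtain cs where cs: "set cs = ?C" "length cs = n"
      using finite_distinct_list[OF fin] by (metis distinct_card)
    have "\<exists>x\<in>level n. c (Copy i x) = cs ! i" if "i < n" for i
    proof -
      have "cs ! i \<in> (\<lambda>x. c (Copy i x)) ` level n"
        using copy[OF that] cs that nth_mem by metis
      then show ?thesis by (auto simp: image_iff)
    qed
    then obtain f where f: "\<And>i. i < n \<Longrightarrow> f i \<in> level n"
        "\<And>i. i < n \<Longrightarrow> c (Copy i (f i)) = cs ! i"
      by metis
    \<comment> \<open>One neighbour in each copy, the \<open>i\<close>-th of colour
      \<open>cs ! i\<close>: together they exhaust \<open>?C\<close>, leaving no colour for
      \<open>a\<close>.\<close>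
    define a where "a = Apex (map f [0..<n])"
    have a: "a \<in> level (Suc n)"
      unfolding a_def level.simps using f by (intro UnI2 imageI) auto
    then obtain i where "i < n" and i: "c a = cs ! i"
      using cs by (metis imageI in_set_conv_nth)
    then have "vertex.adj a (Copy i (f i))"
      by (simp add: a_def vertex.adj_def path_length_self)
    moreover have "Copy i (f i) \<in> level (Suc n)"
      using f \<open>i < n\<close> by auto
    ultimately show False
      using Suc.prems[OF a] f i \<open>i < n\<close> by metis
  qed
qed simp

theorem theorem1p3:
  fixes n :: nat
  shows "\<exists>(V :: nat set) E. simple_graph V E
           \<and> chromatic_number V E \<ge> n
           \<and> clique_number V E \<le> 3
           \<and> (\<forall>S \<subseteq> V. clique_number S (induced S E) \<le> 2
                  \<longrightarrow> chromatic_number S (induced S E) \<le> 4)"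
proof -
  \<comment> \<open>Pulling back along \<open>from_nat\<close> keeps additivity and moves the
    vertices into \<open>nat\<close>; \<open>from_nat (to_nat x) = x\<close> identifies
    \<open>V\<close> with \<open>level n\<close>.\<close>
  define L :: "nat \<Rightarrow> nat \<Rightarrow> nat" where "L x y = path_length (from_nat x) (from_nat y)" for x y
  interpret additive_length L
    by unfold_locales (simp add: L_def vertex.additive)
  define V :: "nat set" where "V = to_nat ` level n"
  define E where "E = induced V adj"
  have fin: "finite V"
    by (simp add: V_def finite_level)
  have graph: "simple_graph V E"
    using fin adj_irrefl adj_sym by (auto simp: simple_graph_def E_def induced_def)
  have "n \<le> chromatic_number V E"
  proof -
    obtain c where c: "proper_colouring V E (chromatic_number V E) c"
      using ex_chromatic_colouring[OF graph] .
    have "n \<le> card ((\<lambda>x. c (to_nat x)) ` level n)"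
      using c by (intro card_colours_level)
        (auto simp: proper_colouring_def E_def induced_def V_def adj_def L_def vertex.adj_def)
    also have "\<dots> \<le> card {..<chromatic_number V E}"
      using c by (intro card_mono) (auto simp: proper_colouring_def V_def)
    finally show ?thesis by simp
  qed
  moreover have "clique_number V E \<le> 3"
  proof (rule clique_number_le[OF fin])
    fix K assume "is_clique V E K"
    then show "card K \<le> 3"
      using fin by (intro card_adj_clique_le)
        (auto simp: is_clique_def E_def induced_def intro: finite_subset)
  qed
  moreover have "chromatic_number S (induced S E) \<le> 4"
    if S: "S \<subseteq> V" and cl: "clique_number S (induced S E) \<le> 2" for S
  proof -
    have "card {x, y, z} \<noteq> 3"
      if "x \<in> S" "y \<in> S" "z \<in> S" "adj x y" "adj y z" "adj x z" for x y z
    proof -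
      have "is_clique S (induced S E) {x, y, z}"
        using that S adj_sym by (auto simp: is_clique_def induced_def E_def)
      then have "card {x, y, z} \<le> 2"
        using card_le_clique_number[of S] cl finite_subset[OF S fin] le_trans by blast
      then show ?thesis by linarith
    qed
    then obtain c where "\<And>x. c x < (4::nat)"
        "\<And>x y. \<lbrakk>x \<in> S; y \<in> S; adj x y\<rbrakk> \<Longrightarrow> c x \<noteq> c y"
      using four_colouring by metis
    then have "proper_colouring S (induced S E) 4 c"
      by (auto simp: proper_colouring_def induced_def E_def)
    then show ?thesis
      by (rule chromatic_number_le)
  qed
  ultimately show ?thesis
    using graph by blast
qed

end
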